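(* Let $n$ and $k$ be positive integers with $n \geq 3$ and $1 \leq k \leq n-1$. Then the $k$-token graph $F_n^{(k)}$ of the fan graph $F_n$ is Hamiltonian.
   Context: All graphs are simple and finite. For a simple graph $G$ of order $n$ and an integer $k$ with $1 \leq k \leq n-1$, the $k$-token graph $G^{(k)}$ of $G$ is the graph whose vertices are the $k$-element subsets of $V(G)$, where two such subsets $A, B$ are adjacent if and only if their symmetric difference $A \triangle B$ is an edge of $G$ (that is, $A \triangle B = \{a,b\}$ with $a$ and $b$ adjacent in $G$). The fan graph $F_n$ is the join of $K_1$ and $P_{n-1}$, where $P_{n-1}$ is the path on $n-1$ vertices; concretely, it has vertex set $\{1,\dots,n\}$, where $1,2,\dots,n-1$ form a path in this order and the vertex $n$ is adjacent to all of $1,\dots,n-1$. A graph is Hamiltonian if it contains a Hamiltonian cycle, i.e. a cycle passing through every vertex exactly once. *)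

theory Defs
  imports "Graph_Theory.Graph_Theory"
begin

text \<open>
  A finite simple graph is a \<^locale>\<open>pair_graph\<close>: a finite vertex set with a symmetric,
  loop-free set of arcs, where the edge \<open>ab\<close> is represented by the two arcs
  \<open>(a, b)\<close> and \<open>(b, a)\<close>.
\<close>

definition fan_graph :: "nat \<Rightarrow> nat pair_pre_digraph" where
  "fan_graph n = \<lparr> pverts = {1..n},
     parcs = {(i, j). i \<in> {1..<n} \<and> j \<in> {1..<n} \<and> (j = i + 1 \<or> i = j + 1)}
           \<union> {(i, n) | i. i \<in> {1..<n}} \<union> {(n, i) | i. i \<in> {1..<n}} \<rparr>"

definition token_graph :: "nat \<Rightarrow> 'a pair_pre_digraph \<Rightarrow> 'a set pair_pre_digraph" where
  "token_graph k G =
     (let V = {A. A \<subseteq> pverts G \<and> card A = k}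
      in \<lparr> pverts = V,
           parcs = {(A, B). A \<in> V \<and> B \<in> V \<and>
                      (\<exists>a b. (a, b) \<in> parcs G \<and> sym_diff A B = {a, b})} \<rparr>)"

text \<open>
  The library's \<^const>\<open>pre_digraph.cycle\<close> is a nonempty closed arc walk whose vertices are
  distinct apart from the coinciding endpoints. In a symmetric digraph it also admits the closed
  walk \<open>a, b, a\<close>, which is not a cycle of the undirected graph; the length bound excludes it.
  Every vertex of a cycle is the tail of one of its arcs.
\<close>

definition hamiltonian_cycle :: "'a pair_pre_digraph \<Rightarrow> ('a \<times> 'a) awalk \<Rightarrow> bool" where
  "hamiltonian_cycle G p \<longleftrightarrow>
     pre_digraph.cycle (with_proj G) p \<and> length p \<ge> 3 \<and> fst ` set p = pverts G"

definition hamiltonian :: "'a pair_pre_digraph \<Rightarrow> bool" where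
  "hamiltonian G \<longleftrightarrow> (\<exists>p. hamiltonian_cycle G p)"

lemma pair_graph_fan_graph: "pair_graph (fan_graph n)"
proof -
  have "parcs (fan_graph n) \<subseteq> {1..n} \<times> {1..n}"
    by (auto simp: fan_graph_def)
  then have "finite (parcs (fan_graph n))"
    by (rule finite_subset) simp
  moreover have "sym (parcs (fan_graph n))"
    by (auto simp: sym_def fan_graph_def)
  moreover have "fst e \<in> pverts (fan_graph n)" "snd e \<in> pverts (fan_graph n)" "fst e \<noteq> snd e"
    if "e \<in> parcs (fan_graph n)" for e
    using that by (auto simp: fan_graph_def)
  moreover have "finite (pverts (fan_graph n))"
    by (simp add: fan_graph_def)
  ultimately show ?thesis
    by unfold_locales (simp_all add: symmetric_def)
qed

lemma pair_graph_token_graph: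
  assumes "pair_graph G"
  shows "pair_graph (token_graph k G)"
proof -
  interpret pair_graph G by fact
  let ?T = "token_graph k G"
  have "pverts ?T \<subseteq> Pow (pverts G)"
    by (auto simp: token_graph_def)
  then have fin: "finite (pverts ?T)"
    by (rule finite_subset) simp
  have wf: "fst e \<in> pverts ?T \<and> snd e \<in> pverts ?T \<and> fst e \<noteq> snd e" if "e \<in> parcs ?T" for e
  proof -
    obtain A B where e: "e = (A, B)"
      by (cases e)
    with that obtain a b where "A \<in> pverts ?T" "B \<in> pverts ?T" and ab: "sym_diff A B = {a, b}"
      unfolding token_graph_def Let_def by force
    moreover have "A \<noteq> B"
      using ab by (metis Diff_cancel Un_absorb insert_not_empty)
    ultimately show ?thesis
      by (simp add: e)
  qed
  have "parcs ?T \<subseteq> pverts ?T \<times> pverts ?T"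
    using wf by (intro subsetI) (simp only: mem_Times_iff)
  then have "finite (parcs ?T)"
    by (rule finite_subset) (simp add: fin)
  moreover have "sym (parcs ?T)"
    unfolding sym_def token_graph_def Let_def
    by (simp only: pair_pre_digraph.select_convs mem_Collect_eq prod.case) (metis Un_commute)
  ultimately show ?thesis
    using fin wf by unfold_locales (simp_all add: symmetric_def del: Un_iff)
qed

end

theory Submission
  imports Defs
begin

text \<open>
  Restrict the fan to \<open>{j..n}\<close>, that is, to the final segment \<open>j, ..., n - 1\<close> of the path together
  with the hub \<open>n\<close>. The \<open>k\<close>-subsets of \<open>{j..n}\<close> that contain \<open>j\<close> are the \<open>(k - 1)\<close>-subsets of
  \<open>{j + 1..n}\<close> with \<open>j\<close> inserted, and inserting a resting token preserves moves of the other tokens.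
  So the configurations of \<open>k\<close> tokens on \<open>{j..n}\<close> split into those on \<open>{j + 1..n}\<close> and a copy of
  those of \<open>k - 1\<close> tokens on \<open>{j + 1..n}\<close>, and one can try to build a Hamiltonian path from paths in
  these two parts.

  The difficulty is to choose endpoints that fit together and return in the result. Write
  \<^item> \<open>S\<^sub>k = {n - k<..n}\<close> for the last \<open>k\<close> vertices including the hub,
  \<^item> \<open>P\<^sub>k = {n - k..<n}\<close> for the last \<open>k\<close> vertices of the path,
  \<^item> \<open>F\<^sub>k\<close> for the vertex \<open>j\<close> with the last \<open>k - 1\<close> vertices of the path.

  On every segment with \<open>j + k \<le> n\<close> there are Hamiltonian paths from \<open>S\<^sub>k\<close> to \<open>P\<^sub>k\<close> and from
  \<open>S\<^sub>k\<close> to \<open>F\<^sub>k\<close>; this is shown by induction on \<open>k\<close> (lemma \<open>token_sets_spanning_paths\<close>). For the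
  step, the part that avoids \<open>j\<close> is traversed by a path \<open>Q\<close> through everything except \<open>S\<^sub>k\<close>, from
  \<open>P\<^sub>k\<close> to \<open>S\<^sub>k\<^sub>-\<^sub>1\<close> with \<open>j + 1\<close> inserted (lemma \<open>spanning_path_without_hub_end\<close>). If
  \<open>j + k = n\<close>, that part is \<open>S\<^sub>k\<close> alone and \<open>P\<^sub>k = F\<^sub>k\<close>; otherwise the two paths are
  \<^item> \<open>S\<^sub>k\<close>, \<open>Q\<close>, a move from \<open>j + 1\<close> to \<open>j\<close>, and the path from \<open>S\<^sub>k\<^sub>-\<^sub>1\<close> to \<open>P\<^sub>k\<^sub>-\<^sub>1\<close> with \<open>j\<close>
    inserted, which ends in \<open>F\<^sub>k\<close>;
  \<^item> \<open>S\<^sub>k\<close>, a move of the hub token to \<open>j\<close>, the second piece backwards, and \<open>Q\<close> backwards, which ends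
    in \<open>P\<^sub>k\<close>.

  Both run through the same cycle from \<open>S\<^sub>k\<close>, in opposite directions. Finally \<open>S\<^sub>k\<close> and \<open>P\<^sub>k\<close> differ by one
  move between \<open>n\<close> and \<open>n - k\<close>, so for \<open>j = 1\<close> the path from \<open>S\<^sub>k\<close> to \<open>P\<^sub>k\<close> closes up to a
  Hamiltonian cycle.
\<close>

section \<open>Spanning paths and Hamiltonian cycles\<close>

text \<open>
  The vertex set is a parameter separate from the relation: a single relation of token moves is used
  on the configurations of different numbers of tokens and on parts of them.
\<close>

definition spanning_path :: "('a \<Rightarrow> 'a \<Rightarrow> bool) \<Rightarrow> 'a set \<Rightarrow> 'a \<Rightarrow> 'a \<Rightarrow> bool" where
  "spanning_path R S x y \<longleftrightarrow>
     (\<exists>xs. xs \<noteq> [] \<and> hd xs = x \<and> last xs = y \<and> distinct xs \<and> set xs = S \<and> successively R xs)"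

lemma spanning_path_singleton: "spanning_path R {x} x x"
  unfolding spanning_path_def by (rule exI[of _ "[x]"]) simp

lemma spanning_path_join:
  assumes "spanning_path R S x y" "R y z" "spanning_path R T z w" "S \<inter> T = {}"
  shows "spanning_path R (S \<union> T) x w"
proof -
  from assms(1) obtain xs where xs: "xs \<noteq> []" "hd xs = x" "last xs = y" "distinct xs" "set xs = S"
    "successively R xs" unfolding spanning_path_def by blast
  from assms(3) obtain ys where ys: "ys \<noteq> []" "hd ys = z" "last ys = w" "distinct ys" "set ys = T"
    "successively R ys" unfolding spanning_path_def by blast
  show ?thesis unfolding spanning_path_def
    using xs ys assms(2,4) by (intro exI[of _ "xs @ ys"]) (simp add: successively_append_iff)
qed

lemma spanning_path_rev:
  assumes "spanning_path R S x y" "symp R"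
  shows "spanning_path R S y x"
proof -
  from assms(1) obtain xs where xs: "xs \<noteq> []" "hd xs = x" "last xs = y" "distinct xs" "set xs = S"
    "successively R xs" unfolding spanning_path_def by blast
  moreover have "successively (\<lambda>u v. R v u) xs"
    by (rule successively_mono[OF xs(6)]) (use assms(2) in \<open>auto dest: sympD\<close>)
  ultimately show ?thesis unfolding spanning_path_def
    by (intro exI[of _ "rev xs"]) (simp add: successively_rev hd_rev last_rev)
qed

lemma spanning_path_image:
  assumes "spanning_path R S x y" "inj_on f S"
    and "\<And>u v. u \<in> S \<Longrightarrow> v \<in> S \<Longrightarrow> R u v \<Longrightarrow> R (f u) (f v)"
  shows "spanning_path R (f ` S) (f x) (f y)"
proof -
  from assms(1) obtain xs where xs: "xs \<noteq> []" "hd xs = x" "last xs = y" "distinct xs" "set xs = S"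
    "successively R xs" unfolding spanning_path_def by blast
  have "successively (\<lambda>u v. R (f u) (f v)) xs"
    by (rule successively_mono[OF xs(6)]) (use assms(3) xs(5) in auto)
  then show ?thesis unfolding spanning_path_def
    using xs assms(2)
    by (intro exI[of _ "map f xs"]) (simp add: successively_map hd_map last_map distinct_map)
qed

lemma cas_vwalk_arcs: "pre_digraph.cas (with_proj G) x (vwalk_arcs (x # xs)) (last (x # xs))"
  by (induction xs arbitrary: x)
    (auto simp: pre_digraph.cas.simps simp del: cas_with_proj_eq vwalk_arcs_Cons)

lemma awalk_verts_vwalk_arcs: "pre_digraph.awalk_verts (with_proj G) x (vwalk_arcs (x # xs)) = x # xs"
  by (induction xs arbitrary: x)
    (auto simp: pre_digraph.awalk_verts.simps simp del: awalk_verts_with_proj_eq vwalk_arcs_Cons)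

lemma set_vwalk_arcs_successively:
  "successively (\<lambda>u v. (u, v) \<in> E) xs \<Longrightarrow> set (vwalk_arcs xs) \<subseteq> E"
  by (induction xs rule: vwalk_arcs.induct) auto

lemma fst_vwalk_arcs: "map fst (vwalk_arcs xs) = butlast xs"
  by (induction xs rule: vwalk_arcs.induct) auto

text \<open>
  The arcs of the closed walk \<open>xs @ [x]\<close> have exactly the entries of \<open>xs\<close> as their tails, so the
  required length and the covering of all vertices can both be read off from \<open>xs\<close>.
\<close>

lemma hamiltonian_if_closed_spanning_path:
  assumes path: "spanning_path (\<lambda>u v. (u, v) \<in> parcs G) (pverts G) x y"
    and closing: "(y, x) \<in> parcs G" and card: "card (pverts G) \<ge> 3"
  shows "hamiltonian G"
proof -
  from path obtain xs where xs: "xs \<noteq> []" "hd xs = x" "last xs = y" "distinct xs"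
    "set xs = pverts G" "successively (\<lambda>u v. (u, v) \<in> parcs G) xs"
    unfolding spanning_path_def by blast
  then obtain ys where ys: "xs = x # ys" by (cases xs) auto
  let ?p = "vwalk_arcs (x # ys @ [x])"
  have fst_p: "map fst ?p = xs"
    by (simp add: fst_vwalk_arcs ys butlast_append del: vwalk_arcs_Cons)
  have "successively (\<lambda>u v. (u, v) \<in> parcs G) (xs @ [x])"
    using xs closing by (simp add: successively_append_iff)
  then have "set ?p \<subseteq> parcs G"
    by (intro set_vwalk_arcs_successively) (simp add: ys)
  moreover have "pre_digraph.cas (with_proj G) x ?p x"
    using cas_vwalk_arcs[of G x "ys @ [x]"] by simp
  moreover have "x \<in> pverts G" using xs ys by auto
  moreover have "distinct (tl (pre_digraph.awalk_verts (with_proj G) x ?p))"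
    using xs(4) ys unfolding awalk_verts_vwalk_arcs by auto
  moreover have len: "length ?p = card (pverts G)"
    using arg_cong[OF fst_p, of length] xs(4,5) distinct_card by fastforce
  moreover have "?p \<noteq> []" using len card by auto
  ultimately have "pre_digraph.cycle (with_proj G) ?p"
    unfolding pre_digraph.cycle_def pre_digraph.awalk_def by auto
  moreover have "fst ` set ?p = pverts G"
    using arg_cong[OF fst_p, of set] xs(5) by (simp only: set_map)
  ultimately show ?thesis
    using len card unfolding hamiltonian_def hamiltonian_cycle_def by (intro exI[of _ ?p]) simp
qed

section \<open>Moves of tokens on the fan\<close>

text \<open>
  Between configurations of equally many tokens this is adjacency in a token graph of the fan. The
  number of tokens does not enter, so that resting tokens can be added.
\<close>

definition token_move :: "nat \<Rightarrow> nat set \<Rightarrow> nat set \<Rightarrow> bool" where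
  "token_move n A B \<longleftrightarrow> (\<exists>a b. (a, b) \<in> parcs (fan_graph n) \<and> sym_diff A B = {a, b})"

lemma symp_token_move: "symp (token_move n)"
  unfolding token_move_def by (rule sympI) (simp add: Un_commute)

lemma token_move_slide:
  assumes "sym_diff A B = {a, a + 1}" "1 \<le> a" "a + 1 < n"
  shows "token_move n A B"
  unfolding token_move_def
  by (rule exI[of _ a], rule exI[of _ "a + 1"]) (use assms in \<open>auto simp: fan_graph_def\<close>)

lemma token_move_hub:
  assumes "sym_diff A B = {a, n}" "1 \<le> a" "a < n"
  shows "token_move n A B"
  unfolding token_move_def
  by (rule exI[of _ a], rule exI[of _ n]) (use assms in \<open>auto simp: fan_graph_def\<close>)

lemma token_move_insert:
  assumes "token_move n A B" "j \<notin> A" "j \<notin> B"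
  shows "token_move n (insert j A) (insert j B)"
proof -
  have "sym_diff (insert j A) (insert j B) = sym_diff A B" using assms(2,3) by auto
  then show ?thesis using assms(1) unfolding token_move_def by simp
qed

section \<open>Configurations on a final segment of the fan\<close>

definition token_sets :: "nat \<Rightarrow> nat \<Rightarrow> nat \<Rightarrow> nat set set" where
  "token_sets n j k = {A. A \<subseteq> {j..n} \<and> card A = k}"

lemma token_sets_0: "token_sets n j 0 = {{}}"
  unfolding token_sets_def by (auto dest: finite_subset)

lemma token_sets_full:
  assumes "j + k = n + 1"
  shows "token_sets n j k = {{j..n}}"
proof -
  have "A = {j..n}" if "A \<subseteq> {j..n}" "card A = k" for A
    using that assms by (intro card_subset_eq) auto
  then show ?thesis using assms unfolding token_sets_def by auto
qed

lemma token_sets_split: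
  assumes "j \<le> n"
  shows "token_sets n j (Suc k) = token_sets n (Suc j) (Suc k) \<union> insert j ` token_sets n (Suc j) k"
proof (intro subset_antisym subsetI)
  have interval: "{j..n} = insert j {Suc j..n}" using assms by auto
  fix A assume A: "A \<in> token_sets n j (Suc k)"
  then have fin: "finite A" unfolding token_sets_def by (auto dest: finite_subset)
  show "A \<in> token_sets n (Suc j) (Suc k) \<union> insert j ` token_sets n (Suc j) k"
  proof (cases "j \<in> A")
    case True
    have "A - {j} \<in> token_sets n (Suc j) k"
      using A True fin unfolding token_sets_def interval by auto
    moreover have "A = insert j (A - {j})" using True by auto
    ultimately show ?thesis by blast
  next
    case False
    then show ?thesis using A unfolding token_sets_def interval by auto
  qed
next
  fix A assume "A \<in> token_sets n (Suc j) (Suc k) \<union> insert j ` token_sets n (Suc j) k"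
  then show "A \<in> token_sets n j (Suc k)"
  proof
    assume "A \<in> token_sets n (Suc j) (Suc k)"
    then show ?thesis unfolding token_sets_def by auto
  next
    assume "A \<in> insert j ` token_sets n (Suc j) k"
    then obtain B where B: "A = insert j B" "B \<subseteq> {Suc j..n}" "card B = k"
      unfolding token_sets_def by auto
    moreover have "finite B" "j \<notin> B" using B by (auto dest: finite_subset)
    ultimately show ?thesis using assms unfolding token_sets_def by auto
  qed
qed

lemma token_sets_split_disjoint:
  "token_sets n (Suc j) l \<inter> insert j ` token_sets n (Suc j) k = {}"
  unfolding token_sets_def by auto

lemma spanning_path_insert:
  assumes "spanning_path (token_move n) (token_sets n (Suc j) k) A B"
  shows "spanning_path (token_move n) (insert j ` token_sets n (Suc j) k) (insert j A) (insert j B)"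
proof (rule spanning_path_image[OF assms])
  have notin: "j \<notin> C" if "C \<in> token_sets n (Suc j) k" for C
    using that unfolding token_sets_def by auto
  show "inj_on (insert j) (token_sets n (Suc j) k)"
    using notin by (intro inj_onI) (metis Diff_insert_absorb)
  show "token_move n (insert j u) (insert j v)"
    if "u \<in> token_sets n (Suc j) k" "v \<in> token_sets n (Suc j) k" "token_move n u v" for u v
    using that notin by (intro token_move_insert)
qed

section \<open>Hamiltonian paths on final segments\<close>

text \<open>
  For \<open>k > 0\<close> these are \<open>j\<close> and the last \<open>k - 1\<close> path vertices \<open>n - k + 1, ..., n - 1\<close>. The case
  \<open>k = 0\<close> is separate because no token can then be on \<open>j\<close>; it lets the induction start at \<open>k = 0\<close>.
\<close>

definition front_set :: "nat \<Rightarrow> nat \<Rightarrow> nat \<Rightarrow> nat set" where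
  "front_set n j k = (if k = 0 then {} else insert j {n - k<..<n})"

text \<open>
  The path is obtained by extending the segment to the left one vertex at a time. For the shortest
  segment, \<open>{n - Suc k<..n}\<close> is the only configuration that avoids \<open>j\<close>, and a path for \<open>k\<close> tokens
  with \<open>j\<close> inserted suffices. A longer segment adds such a copy at the end: the old path ends with
  the tokens \<open>j + 1\<close> and \<open>{n - k<..n}\<close>, one move reaches \<open>front_set n (Suc j) k\<close> with \<open>j\<close> inserted, and
  the copy leads back to \<open>{n - k<..n}\<close> with \<open>j\<close> inserted. So the second endpoint has the same form for every
  \<open>j\<close>, and the first never changes.
\<close>

lemma spanning_path_without_hub_end:
  assumes pathA: "\<And>j. 1 \<le> j \<Longrightarrow> j + k \<le> n \<Longrightarrow>
      spanning_path (token_move n) (token_sets n j k) {n - k<..n} (front_set n j k)"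
    and "1 \<le> j" "j + Suc k \<le> n"
  shows "spanning_path (token_move n) (token_sets n j (Suc k) - {{n - Suc k<..n}})
           {n - Suc k..<n} (insert j {n - k<..n})"
  using assms(3,2)
proof (induction "n - Suc k - j" arbitrary: j)
  case 0
  then have n: "n = j + Suc k" by simp
  have ends: "{n - Suc k<..n} = {Suc j..n}" "insert j (front_set n (Suc j) k) = {n - Suc k..<n}"
    using n by (auto simp: front_set_def)
  have "token_sets n j (Suc k) - {{n - Suc k<..n}} = insert j ` token_sets n (Suc j) k"
    using token_sets_split[of j n k] token_sets_full[of "Suc j" "Suc k" n] n
      token_sets_split_disjoint[of n j "Suc k" k] ends(1) by auto
  moreover have "spanning_path (token_move n) (insert j ` token_sets n (Suc j) k)
      (insert j (front_set n (Suc j) k)) (insert j {n - k<..n})"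
    by (intro spanning_path_insert spanning_path_rev[OF pathA] symp_token_move) (use n in auto)
  ultimately show ?case using ends(2) by simp
next
  case (Suc d)
  then have lt: "j + Suc k < n" by simp
  let ?s = "{n - Suc k<..n}"
  have "spanning_path (token_move n) (token_sets n (Suc j) (Suc k) - {?s})
      {n - Suc k..<n} (insert (Suc j) {n - k<..n})"
    using Suc.hyps(2) lt by (intro Suc.hyps(1)) auto
  moreover have "token_move n (insert (Suc j) {n - k<..n}) (insert j (front_set n (Suc j) k))"
  \<comment> \<open>Normally the hub token moves to \<open>j\<close>. A single token, on \<open>j + 1\<close>, slides to \<open>j\<close>.\<close>
  proof (cases "k = 0")
    case True
    show ?thesis
      by (rule token_move_slide[of _ _ j]) (use True lt Suc.prems in \<open>auto simp: front_set_def\<close>)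
  next
    case False
    show ?thesis
      by (rule token_move_hub[of _ _ j]) (use False lt Suc.prems in \<open>auto simp: front_set_def\<close>)
  qed
  moreover have "spanning_path (token_move n) (insert j ` token_sets n (Suc j) k)
      (insert j (front_set n (Suc j) k)) (insert j {n - k<..n})"
    by (intro spanning_path_insert spanning_path_rev[OF pathA] symp_token_move) (use lt in auto)
  moreover have "(token_sets n (Suc j) (Suc k) - {?s}) \<inter> insert j ` token_sets n (Suc j) k = {}"
    using token_sets_split_disjoint by blast
  ultimately have "spanning_path (token_move n)
      (token_sets n (Suc j) (Suc k) - {?s} \<union> insert j ` token_sets n (Suc j) k)
      {n - Suc k..<n} (insert j {n - k<..n})"
    by (rule spanning_path_join)
  moreover have "j \<notin> ?s" using lt by simp
  then have "?s \<notin> insert j ` token_sets n (Suc j) k" by blast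
  then have "token_sets n (Suc j) (Suc k) - {?s} \<union> insert j ` token_sets n (Suc j) k
      = token_sets n j (Suc k) - {?s}"
    using token_sets_split[of j n k] lt by auto
  ultimately show ?case by simp
qed

text \<open>
  The two paths have to be proved together: extending the path to \<open>front_set\<close> uses the path to
  \<open>{n - k..<n}\<close> for one token less, and the path of the preceding lemma, which both extensions use,
  rests on the path to \<open>front_set\<close> for one token less.
\<close>

lemma token_sets_spanning_paths:
  assumes "1 \<le> j" "j + k \<le> n"
  shows "spanning_path (token_move n) (token_sets n j k) {n - k<..n} (front_set n j k)"
    and "spanning_path (token_move n) (token_sets n j k) {n - k<..n} {n - k..<n}"
proof -
  let ?P = "\<lambda>j k. spanning_path (token_move n) (token_sets n j k)"
  have "?P j k {n - k<..n} (front_set n j k) \<and> ?P j k {n - k<..n} {n - k..<n}"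
    using assms
  proof (induction k arbitrary: j)
    case 0
    show ?case by (simp add: token_sets_0 front_set_def spanning_path_singleton)
  next
    case (Suc k)
    let ?s = "{n - Suc k<..n}" and ?b = "{n - Suc k..<n}"
    let ?U = "token_sets n (Suc j) (Suc k)" and ?I = "insert j ` token_sets n (Suc j) k"
    have le: "1 \<le> j" "j + Suc k \<le> n" using Suc.prems by auto
    have split: "token_sets n j (Suc k) = ?U \<union> ?I" "?U \<inter> ?I = {}"
      using le token_sets_split[of j n k] token_sets_split_disjoint[of n j "Suc k" k] by simp_all
    have s: "?s \<in> ?U" using le unfolding token_sets_def by auto
    have front: "insert j {n - k..<n} = front_set n j (Suc k)"
      using le by (auto simp: front_set_def)
    have I: "spanning_path (token_move n) ?I (insert j {n - k<..n}) (front_set n j (Suc k))"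
      unfolding front[symmetric] using Suc.IH[of "Suc j"] le by (intro spanning_path_insert) auto
    show ?case
    proof (cases "j + Suc k = n")
      case True
      \<comment> \<open>Here \<open>?s\<close> is the only configuration without \<open>j\<close>, and the two required endpoints coincide.\<close>
      have U: "?U = {?s}"
        using token_sets_full[of "Suc j" "Suc k" n] True s by simp
      have "token_move n ?s (insert j {n - k<..n})"
      \<comment> \<open>The vertex added to \<open>{n - k<..n}\<close> moves from \<open>n - k\<close> to \<open>j\<close>; for \<open>k = 0\<close> it is the hub.\<close>
      proof (cases "k = 0")
        case True
        show ?thesis by (rule token_move_hub[of _ _ j]) (use True \<open>j + Suc k = n\<close> le in auto)
      next
        case False
        show ?thesis by (rule token_move_slide[of _ _ j]) (use False \<open>j + Suc k = n\<close> le in auto)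
      qed
      from spanning_path_singleton this I split(2)[unfolded U]
      have "?P j (Suc k) ?s (front_set n j (Suc k))"
        unfolding split(1) U by (rule spanning_path_join)
      moreover have "front_set n j (Suc k) = ?b" using True by (auto simp: front_set_def)
      ultimately show ?thesis by simp
    next
      case False
      with le have lt: "j + Suc k < n" by simp
      have Q: "spanning_path (token_move n) (?U - {?s}) ?b (insert (Suc j) {n - k<..n})"
        by (rule spanning_path_without_hub_end) (use Suc.IH lt in auto)
      have U: "{?s} \<union> (?U - {?s}) = ?U" using s by blast
      have slide: "token_move n (insert (Suc j) {n - k<..n}) (insert j {n - k<..n})"
        by (rule token_move_slide[of _ _ j]) (use lt le in auto)
      have "token_move n ?s ?b"
        by (rule token_move_hub[of _ _ "n - Suc k"]) (use lt in auto)
      from spanning_path_join[OF spanning_path_singleton this Q]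
      have "spanning_path (token_move n) ?U ?s (insert (Suc j) {n - k<..n})"
        unfolding U by simp
      from this slide I split(2)
      have A: "?P j (Suc k) ?s (front_set n j (Suc k))"
        unfolding split(1) by (rule spanning_path_join)
      \<comment> \<open>The same cycle in the other direction: start with the configurations containing \<open>j\<close>.\<close>
      have "token_move n ?s (front_set n j (Suc k))"
        by (rule token_move_hub[of _ _ j]) (use lt le in \<open>auto simp: front_set_def\<close>)
      moreover have "spanning_path (token_move n) ?I (front_set n j (Suc k)) (insert j {n - k<..n})"
        using I symp_token_move by (rule spanning_path_rev)
      moreover have "{?s} \<inter> ?I = {}" using s split(2) by blast
      ultimately have "spanning_path (token_move n) ({?s} \<union> ?I) ?s (insert j {n - k<..n})"
        by (rule spanning_path_join[OF spanning_path_singleton])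
      moreover have "token_move n (insert j {n - k<..n}) (insert (Suc j) {n - k<..n})"
        using slide symp_token_move by (metis sympD)
      moreover have "spanning_path (token_move n) (?U - {?s}) (insert (Suc j) {n - k<..n}) ?b"
        using Q symp_token_move by (rule spanning_path_rev)
      moreover have "({?s} \<union> ?I) \<inter> (?U - {?s}) = {}" using split(2) by blast
      ultimately have "spanning_path (token_move n) (({?s} \<union> ?I) \<union> (?U - {?s})) ?s ?b"
        by (rule spanning_path_join)
      moreover have "({?s} \<union> ?I) \<union> (?U - {?s}) = token_sets n j (Suc k)"
        unfolding split(1) using s by blast
      ultimately show ?thesis using A by simp
    qed
  qed
  then show "?P j k {n - k<..n} (front_set n j k)" "?P j k {n - k<..n} {n - k..<n}" by auto
qed

section \<open>The Hamiltonian cycle\<close>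

lemma le_choose:
  assumes "1 \<le> k" "k < n"
  shows "n \<le> n choose k"
  using assms(2)
proof (induction n)
  case 0
  then show ?case by simp
next
  case (Suc n)
  show ?case
  proof (cases "k = n")
    case True
    then show ?thesis by simp
  next
    case False
    with Suc.prems have "k < n" by simp
    moreover obtain l where "k = Suc l" using assms(1) by (cases k) auto
    ultimately have "n \<le> n choose Suc l" "0 < n choose l" using Suc.IH by auto
    then show ?thesis using \<open>k = Suc l\<close> by (simp del: zero_less_binomial_iff)
  qed
qed

theorem theorem2p3:
  fixes n k :: nat
  assumes "n \<ge> 3" and "1 \<le> k" and "k \<le> n - 1"
  shows "hamiltonian (token_graph k (fan_graph n))"
proof -
  let ?G = "token_graph k (fan_graph n)"
  have verts: "pverts ?G = token_sets n 1 k"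
    unfolding token_graph_def token_sets_def fan_graph_def by simp
  have arc: "(A, B) \<in> parcs ?G"
    if "token_move n A B" "A \<in> token_sets n 1 k" "B \<in> token_sets n 1 k" for A B
    using that unfolding token_graph_def token_sets_def token_move_def
    by (simp add: Let_def) (simp add: fan_graph_def)
  let ?s = "{n - k<..n}" and ?b = "{n - k..<n}"
  have in_verts: "?s \<in> token_sets n 1 k" "?b \<in> token_sets n 1 k"
    using assms unfolding token_sets_def by auto
  have "spanning_path (token_move n) (token_sets n 1 k) ?s ?b"
    using assms by (intro token_sets_spanning_paths) auto
  then have "spanning_path (\<lambda>A B. (A, B) \<in> parcs ?G) (pverts ?G) ?s ?b"
    unfolding verts spanning_path_def
    by (metis (mono_tags, lifting) arc successively_mono)
  moreover have "token_move n ?b ?s"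
    by (rule token_move_hub[of _ _ "n - k"]) (use assms in auto)
  then have "(?b, ?s) \<in> parcs ?G" using in_verts by (intro arc)
  moreover have "card (pverts ?G) = n choose k"
    unfolding verts token_sets_def using n_subsets[of "{1..n}" k] by simp
  then have "3 \<le> card (pverts ?G)" using le_choose[of k n] assms by linarith
  ultimately show ?thesis by (rule hamiltonian_if_closed_spanning_path)
qed

end
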